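(* Let $q$ be a complex number with $|q|<1$, let $a$ be an arbitrary complex number, and let $b,t$ be complex numbers with $|b|<1$ and $|t|<1$. Then $$\sum_{n\ge 0}\frac{(-abq^{n+1};q)_{n}\,t^n}{(bq^{n};q)_{n+1}}=\sum_{n\ge 0}\frac{(-atq^{n+1};q)_{n}\,b^n}{(tq^{n};q)_{n+1}}.$$
   Context: For complex $z$ and $q$ and an integer $n\ge 0$, the $q$-shifted factorial is $(z;q)_n=\prod_{k=0}^{n-1}(1-zq^k)$, with $(z;q)_0=1$. The convention $q^0=1$ is used throughout. *)

theory Defs
  imports Complex_Main
begin

definition qpoch :: "complex \<Rightarrow> complex \<Rightarrow> nat \<Rightarrow> complex" where
  "qpoch z q n = (\<Prod>k<n. 1 - z * q ^ k)"

end

theory Submission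
  imports Defs "HOL-Analysis.Infinite_Sum" "HOL-Analysis.Infinite_Products"
begin

text \<open>
  Expanding the numerator by the finite \<open>q\<close>-binomial theorem and the reciprocal of the denominator by
  its companion series turns the left-hand side into an absolutely convergent triple sum with summand
  \[ \frac{(q;q)_{n+k}}{(q;q)_j (q;q)_{n-j} (q;q)_k}\, a^j q^{j(j+1)/2}\, q^{n(j+k)}\, b^{j+k} t^n
     \qquad (0 \le j \le n,\ k \ge 0). \]
  The involution \<open>(n, j, k) \<mapsto> (j + k, j, n - j)\<close> interchanges the roles of \<open>b\<close> and \<open>t\<close>.
\<close>

section \<open>Gaussian binomial coefficients\<close>

text \<open>The value 0 above the diagonal lets the q-Pascal rule cover \<open>k = n\<close> as
  well.\<close>

definition qbinom :: "complex \<Rightarrow> nat \<Rightarrow> nat \<Rightarrow> complex" where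
  "qbinom q n k = (if k \<le> n then qpoch q q n / (qpoch q q k * qpoch q q (n - k)) else 0)"

lemma qpoch_0 [simp]: "qpoch z q 0 = 1"
  by (simp add: qpoch_def)

lemma qpoch_Suc: "qpoch z q (Suc n) = qpoch z q n * (1 - z * q ^ n)"
  by (simp add: qpoch_def)

lemma power_neq_one_of_norm_less_one:
  fixes q :: complex
  assumes "norm q < 1"
  shows "q ^ Suc k \<noteq> 1"
  using power_Suc_less_one[of "norm q" k] assms
  by (metis norm_ge_zero norm_one norm_power less_irrefl power_less_one_iff zero_less_Suc)

lemma qpoch_self_nonzero:
  assumes "norm q < 1"
  shows "qpoch q q n \<noteq> 0"
  using power_neq_one_of_norm_less_one[OF assms] by (auto simp: qpoch_def)

lemma qbinom_0 [simp]: "norm q < 1 \<Longrightarrow> qbinom q n 0 = 1"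
  by (simp add: qbinom_def qpoch_self_nonzero)

lemma qbinom_self [simp]: "norm q < 1 \<Longrightarrow> qbinom q n n = 1"
  by (simp add: qbinom_def qpoch_self_nonzero)

lemma qbinom_gt [simp]: "n < k \<Longrightarrow> qbinom q n k = 0"
  by (simp add: qbinom_def)

text \<open>One of the two q-Pascal rules. For k < n, dividing out (q;q)_n / ((q;q)_(k+1)
  (q;q)_(n-k)) leaves 1 - q^(n+1) = (1 - q^(n-k)) + q^(n-k) (1 - q^(k+1)). It drives both expansions
  below.\<close>

lemma qbinom_Suc_Suc:
  assumes "norm q < 1" and "k \<le> n"
  shows "qbinom q (Suc n) (Suc k) = qbinom q n (Suc k) + q ^ (n - k) * qbinom q n k"
proof (cases "k = n")
  case True
  then show ?thesis
    using assms by simp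
next
  case False
  with assms(2) obtain d where n: "n = Suc (k + d)"
    using less_imp_Suc_add[of k n] by force
  have nz: "qpoch q q m \<noteq> 0" "1 - q * q ^ m \<noteq> 0" for m
    using qpoch_self_nonzero[OF assms(1), of m] power_neq_one_of_norm_less_one[OF assms(1), of m]
    by auto
  show ?thesis
    using nz[of k] nz[of d] by (simp add: qbinom_def n qpoch_Suc Suc_diff_le divide_simps power_add)
      (simp add: algebra_simps power_add)
qed

text \<open>The sequence (q;q)_n converges to a nonzero infinite product, so both it and its
  reciprocals are bounded. The bound is uniform in both indices, as a majorant for the triple sum
  requires.\<close>

lemma qbinom_bounded:
  assumes "norm q < 1"
  obtains K where "\<And>n k. norm (qbinom q n k) \<le> K"
proof -
  let ?f = "\<lambda>k. 1 - q * q ^ k"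
  have "summable (\<lambda>k. norm (?f k - 1))"
    using assms by (simp add: norm_mult norm_power summable_mult summable_geometric)
  then have conv: "convergent_prod ?f"
    by (intro abs_convergent_prod_imp_convergent_prod) (simp add: abs_convergent_prod_conv_summable)
  have nz: "prodinf ?f \<noteq> 0"
    using prodinf_nonzero[OF conv] power_neq_one_of_norm_less_one[OF assms] by simp
  have lim: "(\<lambda>n. qpoch q q n) \<longlonglongrightarrow> prodinf ?f"
    using convergent_prod_LIMSEQ[OF conv] unfolding qpoch_def
    by (simp add: LIMSEQ_lessThan_iff_atMost)
  obtain A where A: "\<And>n. norm (qpoch q q n) \<le> A"
    using convergent_imp_Bseq[OF convergentI[OF lim]] by (auto simp: Bseq_def)
  obtain B where B: "\<And>n. norm (inverse (qpoch q q n)) \<le> B"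
    using convergent_imp_Bseq[OF convergentI[OF tendsto_inverse[OF lim nz]]]
    by (auto simp: Bseq_def)
  have nonneg: "0 \<le> A" "0 \<le> B"
    using A[of 0] B[of 0] by auto
  have "norm (qbinom q n k) \<le> A * (B * B)" for n k
  proof (cases "k \<le> n")
    case True
    have "qbinom q n k = qpoch q q n * (inverse (qpoch q q k) * inverse (qpoch q q (n - k)))"
      using True by (simp add: qbinom_def divide_inverse)
    moreover have "norm \<dots> \<le> A * (B * B)"
      unfolding norm_mult by (intro mult_mono A B mult_nonneg_nonneg nonneg norm_ge_zero)
    ultimately show ?thesis
      by simp
  qed (use nonneg in simp)
  then show ?thesis
    by (rule that)
qed

section \<open>The finite q-binomial theorem and its companion series\<close>

lemma qpoch_eq_sum_qbinom:
  assumes "norm q < 1"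
  shows "qpoch (- z) q n = (\<Sum>j\<le>n. qbinom q n j * q ^ (j choose 2) * z ^ j)"
proof (induction n)
  case 0
  then show ?case
    using assms by (simp add: numeral_2_eq_2)
next
  case (Suc n)
  let ?c = "\<lambda>n j. qbinom q n j * q ^ (j choose 2) * z ^ j"
  \<comment> \<open>The Pascal weight q^(n-j) and the factor q^j from
    \<open>Suc j choose 2 = (j choose 2) + j\<close> combine to q^n, which is free of j. Summing
    over j thus produces the new factor 1 + z q^n.\<close>
  have step: "?c (Suc n) (Suc j) = ?c n (Suc j) + z * q ^ n * ?c n j" if "j \<le> n" for j
  proof -
    have "q ^ n = q ^ (n - j) * q ^ j"
      using that by (simp flip: power_add)
    then show ?thesis
      using that by (simp add: qbinom_Suc_Suc[OF assms] numeral_2_eq_2 power_add algebra_simps)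
  qed
  have c0: "?c m 0 = 1" for m
    using assms by (simp add: binomial_eq_0)
  have "(\<Sum>j\<le>Suc n. ?c (Suc n) j) = 1 + (\<Sum>j\<le>n. ?c (Suc n) (Suc j))"
    by (simp only: sum.atMost_Suc_shift c0)
  also have "\<dots> = 1 + (\<Sum>j\<le>n. ?c n (Suc j) + z * q ^ n * ?c n j)"
    by (simp add: step del: power_Suc)
  also have "\<dots> = (1 + (\<Sum>j\<le>n. ?c n (Suc j))) + z * q ^ n * (\<Sum>j\<le>n. ?c n j)"
    by (simp add: sum.distrib sum_distrib_left)
  also have "1 + (\<Sum>j\<le>n. ?c n (Suc j)) = (\<Sum>j\<le>Suc n. ?c n j)"
    by (simp only: sum.atMost_Suc_shift c0)
  \<comment> \<open>The top term vanishes because \<open>qbinom q n (Suc n) = 0\<close>.\<close>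
  also have "\<dots> = (\<Sum>j\<le>n. ?c n j)"
    by simp
  finally show ?case
    by (simp add: qpoch_Suc Suc algebra_simps)
qed

lemma summable_qbinom_power:
  assumes "norm q < 1" and "norm z < 1"
  shows "summable (\<lambda>k. norm (qbinom q (n + k) k * z ^ k))"
proof -
  obtain K where K: "\<And>n k. norm (qbinom q n k) \<le> K"
    using qbinom_bounded[OF assms(1)] by blast
  have "summable (\<lambda>k. K * norm z ^ k)"
    using assms by (intro summable_mult summable_geometric) simp
  then show ?thesis
    by (rule summable_comparison_test') (auto simp: norm_mult norm_power intro!: mult_right_mono K)
qed

text \<open>Induction from the geometric series: by the q-Pascal rule, multiplying the series for
  \<open>Suc n\<close> by 1 - z q^(n+1) gives the series for n.\<close>

lemma qbinom_sums_inverse_qpoch: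
  assumes "norm q < 1" and "norm z < 1"
  shows "(\<lambda>k. qbinom q (n + k) k * z ^ k) sums inverse (qpoch z q (Suc n))"
proof (induction n)
  case 0
  show ?case
    using geometric_sums[OF assms(2)] assms(1) by (simp add: qpoch_Suc inverse_eq_divide)
next
  case (Suc n)
  let ?f = "\<lambda>k. qbinom q (Suc n + k) k * z ^ k"
  have "norm (z * q ^ Suc n) < 1"
    using assms by (simp add: norm_mult norm_power order.strict_trans1[OF mult_left_le] power_le_one
        del: power_Suc)
  then have nz: "1 - z * q ^ Suc n \<noteq> 0"
    by auto
  have S: "?f sums suminf ?f"
    using summable_qbinom_power[OF assms, of "Suc n"]
    by (rule summable_sums[OF summable_norm_cancel])
  \<comment> \<open>The q-Pascal rule relates the coefficients at k + 1 and k, so the series is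
    shifted by one. The constant terms split off, here and for n, are both 1 and cancel at the
    end.\<close>
  have "(\<lambda>k. ?f (Suc k)) sums (suminf ?f - ?f 0)"
    by (subst sums_Suc_iff, subst diff_add_cancel) (rule S)
  then have "(\<lambda>k. ?f (Suc k) - z * q ^ Suc n * ?f k)
      sums (suminf ?f - ?f 0 - z * q ^ Suc n * suminf ?f)"
    by (rule sums_diff[OF _ sums_mult[OF S]])
  moreover have "?f (Suc k) - z * q ^ Suc n * ?f k = qbinom q (n + Suc k) (Suc k) * z ^ Suc k" for k
    using qbinom_Suc_Suc[OF assms(1), of k "n + Suc k"] by (simp add: algebra_simps)
  ultimately have "(\<lambda>k. qbinom q (n + Suc k) (Suc k) * z ^ Suc k)
      sums (suminf ?f - ?f 0 - z * q ^ Suc n * suminf ?f)"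
    by simp
  moreover have "(\<lambda>k. qbinom q (n + Suc k) (Suc k) * z ^ Suc k)
      sums (inverse (qpoch z q (Suc n)) - 1)"
    using Suc assms by (subst sums_Suc_iff) simp
  ultimately have "suminf ?f - ?f 0 - z * q ^ Suc n * suminf ?f = inverse (qpoch z q (Suc n)) - 1"
    by (rule sums_unique2)
  then have "suminf ?f * (1 - z * q ^ Suc n) = inverse (qpoch z q (Suc n))"
    using assms(1) by (simp add: algebra_simps)
  then have "suminf ?f = inverse (qpoch z q (Suc (Suc n)))"
    using nz by (metis divide_inverse inverse_mult_distrib nonzero_eq_divide_eq qpoch_Suc)
  with S show ?case
    by simp
qed

section \<open>The triple sum: symmetry and absolute convergence\<close>

text \<open>The two binomials stay separate, and q^(j(j+1)/2) a^j is split as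
  \<open>q ^ (j choose 2) * (a * q) ^ j\<close>, so that for fixed n the two expansions above can be
  read off directly.\<close>

definition qterm :: "complex \<Rightarrow> complex \<Rightarrow> complex \<Rightarrow> complex \<Rightarrow> nat \<times> nat \<times> nat \<Rightarrow> complex" where
  "qterm q a b t = (\<lambda>(n, j, k). qbinom q n j * qbinom q (n + k) k * q ^ (j choose 2) * (a * q) ^ j
     * q ^ (n * (j + k)) * b ^ (j + k) * t ^ n)"

text \<open>In the first binomial product (q;q)_n cancels, in the second (q;q)_(j+k); both leave
  (q;q)_(n+k) / ((q;q)_j (q;q)_(n-j) (q;q)_k). The exponent n(j+k) is symmetric under the
  swap.\<close>

lemma qterm_swap:
  assumes "norm q < 1" and "j \<le> n"
  shows "qterm q a b t (n, j, k) = qterm q a t b (j + k, j, n - j)"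
proof -
  have "qbinom q n j * qbinom q (n + k) k = qbinom q (j + k) j * qbinom q (n + k) (n - j)"
    using assms by (simp add: qbinom_def qpoch_self_nonzero field_simps)
  then show ?thesis
    using assms(2) by (simp add: qterm_def mult_ac add_ac)
qed

text \<open>Each term is the previous one times x r^j, and this factor tends to 0 for every x. This
  is what allows a to be arbitrary.\<close>

lemma summable_power_choose_two:
  fixes r x :: real
  assumes "0 \<le> r" and "r < 1"
  shows "summable (\<lambda>j. r ^ (j choose 2) * x ^ j)"
proof -
  have "(\<lambda>j. \<bar>x\<bar> * r ^ j) \<longlonglongrightarrow> 0"
    using assms by (auto intro!: tendsto_eq_intros LIMSEQ_power_zero)
  then have "\<forall>\<^sub>F j in sequentially. \<bar>x\<bar> * r ^ j < 1 / 2"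
    by (rule order_tendstoD) simp
  then obtain N where N: "\<And>j. j \<ge> N \<Longrightarrow> \<bar>x\<bar> * r ^ j < 1 / 2"
    by (auto simp: eventually_sequentially)
  show ?thesis
  proof (rule summable_ratio_test[of "1 / 2" N])
    fix j assume "j \<ge> N"
    have "norm (r ^ (Suc j choose 2) * x ^ Suc j) = (\<bar>x\<bar> * r ^ j) * norm (r ^ (j choose 2) * x ^ j)"
      using assms by (simp add: numeral_2_eq_2 power_add abs_mult power_abs)
    also have "\<dots> \<le> 1 / 2 * norm (r ^ (j choose 2) * x ^ j)"
      using N[OF \<open>j \<ge> N\<close>] by (intro mult_right_mono) auto
    finally show "norm (r ^ (Suc j choose 2) * x ^ Suc j) \<le> 1 / 2 * norm (r ^ (j choose 2) * x ^ j)" .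
  qed simp
qed

lemma abs_summable_times:
  fixes f :: "'a \<Rightarrow> 'c :: real_normed_div_algebra" and g :: "'b \<Rightarrow> 'c"
  assumes "f abs_summable_on A" and "g abs_summable_on B"
  shows "(\<lambda>(x, y). f x * g y) abs_summable_on A \<times> B"
  using assms
  by (simp add: abs_summable_on_Sigma_iff norm_mult infsum_cmult_right' summable_on_cmult_right
      summable_on_cmult_left abs_mult infsum_nonneg)

lemma qterm_summable:
  assumes "norm q < 1" and "norm b < 1" and "norm t < 1"
  shows "qterm q a b t summable_on A"
proof -
  obtain K where K: "\<And>n k. norm (qbinom q n k) \<le> K"
    using qbinom_bounded[OF assms(1)] by blast
  have "0 \<le> K"
    using K[of 0 0] by (rule order.trans[OF norm_ge_zero])
  let ?c = "\<lambda>j. norm q ^ (j choose 2) * norm a ^ j"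
  let ?g = "\<lambda>(n, j, k). norm t ^ n * (?c j * norm b ^ k)"
  have geo: "(\<lambda>n. norm x ^ n) abs_summable_on UNIV" if "norm x < 1" for x :: complex
    using that by (intro norm_summable_imp_summable_on) (simp add: norm_power summable_geometric)
  have c: "?c abs_summable_on UNIV"
    using summable_power_choose_two[of "norm q" "norm a"] assms(1)
    by (intro norm_summable_imp_summable_on) (simp add: norm_mult norm_power)
  have "(\<lambda>(j, k). ?c j * norm b ^ k) abs_summable_on UNIV \<times> UNIV"
    using abs_summable_times[OF c geo[OF assms(2)]] by simp
  from abs_summable_times[OF geo[OF assms(3)] this]
  have "?g abs_summable_on UNIV"
    by (simp add: case_prod_unfold)
  then have "(\<lambda>x. (K * K) * ?g x) abs_summable_on UNIV"
    unfolding norm_mult by (rule summable_on_cmult_right)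
  then have "qterm q a b t abs_summable_on UNIV"
  proof (rule abs_summable_on_comparison_test)
    fix x :: "nat \<times> nat \<times> nat"
    obtain n j k where x: "x = (n, j, k)"
      by (cases x)
    have le1: "norm z ^ m \<le> 1" if "norm z < 1" for z :: complex and m
      using that by (simp add: power_le_one)
    have "norm (qterm q a b t x) = (norm (qbinom q n j) * norm (qbinom q (n + k) k))
        * (norm t ^ n * (?c j * norm b ^ k)) * (norm q ^ j * norm q ^ (n * (j + k)) * norm b ^ j)"
      by (simp add: x qterm_def norm_mult norm_power power_mult_distrib power_add mult_ac)
    \<comment> \<open>The last three factors, including the coupling q^(n(j+k)), are bounded by 1;
      the remaining majorant is a product of three convergent single series.\<close>
    also have "\<dots> \<le> (K * K) * (norm t ^ n * (?c j * norm b ^ k)) * (1 * 1 * 1)"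
      using \<open>0 \<le> K\<close> by (intro mult_mono K le1 assms mult_nonneg_nonneg) auto
    also have "\<dots> = norm ((K * K) * ?g x)"
      using \<open>0 \<le> K\<close> by (simp add: x abs_mult)
    finally show "norm (qterm q a b t x) \<le> norm ((K * K) * ?g x)" .
  qed
  then show ?thesis
    by (rule summable_on_subset_banach[OF abs_summable_summable subset_UNIV])
qed

section \<open>Recovering the two series from the triple sum\<close>

lemma qterm_infsum_inner:
  assumes "norm q < 1" and "norm b < 1" and "norm t < 1"
  shows "(\<Sum>\<^sub>\<infinity>y\<in>{..n} \<times> UNIV. qterm q a b t (n, y))
    = qpoch (- a * b * q ^ (n + 1)) q n * t ^ n / qpoch (b * q ^ n) q (n + 1)"
proof -
  let ?u = "\<lambda>j. qbinom q n j * q ^ (j choose 2) * (a * b * q ^ (n + 1)) ^ j"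
  let ?v = "\<lambda>k. qbinom q (n + k) k * (b * q ^ n) ^ k"
  have small: "norm (b * q ^ n) < 1"
    using assms by (simp add: norm_mult norm_power order.strict_trans1[OF mult_left_le] power_le_one)
  have "(\<lambda>x. qterm q a b t x) summable_on Pair n ` ({..n} \<times> UNIV)"
    by (rule qterm_summable[OF assms])
  then have summ: "(\<lambda>y. qterm q a b t (n, y)) summable_on {..n} \<times> UNIV"
    by (subst (asm) summable_on_reindex) (auto simp: inj_on_def o_def)
  \<comment> \<open>For fixed n, the factor q^(n(j+k)) b^(j+k) is distributed over j and k. The
    j-part becomes the numerator with argument a b q^(n+1), the k-part the reciprocal denominator
    with argument b q^n.\<close>
  have split: "qterm q a b t (n, j, k) = t ^ n * ?u j * ?v k" for j k
    by (simp add: qterm_def power_mult_distrib power_add power_mult[symmetric] mult_ac distrib_left)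
  have v: "(\<Sum>\<^sub>\<infinity>k. ?v k) = inverse (qpoch (b * q ^ n) q (Suc n))"
    using norm_summable_imp_has_sum[OF summable_qbinom_power qbinom_sums_inverse_qpoch]
      assms(1) small by (blast intro: infsumI)
  have "(\<Sum>\<^sub>\<infinity>y\<in>{..n} \<times> UNIV. qterm q a b t (n, y))
      = (\<Sum>\<^sub>\<infinity>j\<in>{..n}. \<Sum>\<^sub>\<infinity>k. qterm q a b t (n, j, k))"
    by (rule infsum_Sigma_banach[OF summ, symmetric])
  also have "\<dots> = (\<Sum>j\<le>n. t ^ n * ?u j * inverse (qpoch (b * q ^ n) q (Suc n)))"
    by (simp only: split infsum_cmult_right' v infsum_finite finite_atMost)
  also have "\<dots> = t ^ n * (\<Sum>j\<le>n. ?u j) * inverse (qpoch (b * q ^ n) q (Suc n))"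
    by (simp add: sum_distrib_left sum_distrib_right)
  also have "(\<Sum>j\<le>n. ?u j) = qpoch (- a * b * q ^ (n + 1)) q n"
    using qpoch_eq_sum_qbinom[OF assms(1), of "a * b * q ^ (n + 1)" n] by simp
  finally show ?thesis
    by (simp add: divide_inverse mult_ac)
qed

lemma qseries_sums_infsum_qterm:
  assumes "norm q < 1" and "norm b < 1" and "norm t < 1"
  shows "(\<lambda>n. qpoch (- a * b * q ^ (n + 1)) q n * t ^ n / qpoch (b * q ^ n) q (n + 1))
    sums (\<Sum>\<^sub>\<infinity>x\<in>(SIGMA n:UNIV. {..n} \<times> UNIV). qterm q a b t x)"
proof -
  let ?S = "SIGMA n:UNIV. {..n} \<times> (UNIV :: nat set)"
  have summ: "qterm q a b t summable_on ?S"
    by (rule qterm_summable[OF assms])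
  \<comment> \<open>Fubini over the slices of fixed n; the unordered sum over n then yields the
    ordered series together with its convergence.\<close>
  have "((\<lambda>n. \<Sum>\<^sub>\<infinity>y\<in>{..n} \<times> UNIV. qterm q a b t (n, y)) has_sum infsum (qterm q a b t) ?S) UNIV"
    using summable_on_Sigma_banach[of "\<lambda>n y. qterm q a b t (n, y)" UNIV "\<lambda>n. {..n} \<times> UNIV"]
      infsum_Sigma_banach[OF summ] summ
    by (simp add: has_sum_iff)
  then show ?thesis
    by (simp only: qterm_infsum_inner[OF assms] has_sum_imp_sums)
qed

theorem theorem1p1:
  fixes q a b t :: complex
  assumes "norm q < 1" and "norm b < 1" and "norm t < 1"
  shows "summable (\<lambda>n. qpoch (- a * b * q ^ (n + 1)) q n * t ^ n / qpoch (b * q ^ n) q (n + 1))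
    \<and> summable (\<lambda>n. qpoch (- a * t * q ^ (n + 1)) q n * b ^ n / qpoch (t * q ^ n) q (n + 1))
    \<and> (\<Sum>n. qpoch (- a * b * q ^ (n + 1)) q n * t ^ n / qpoch (b * q ^ n) q (n + 1))
      = (\<Sum>n. qpoch (- a * t * q ^ (n + 1)) q n * b ^ n / qpoch (t * q ^ n) q (n + 1))"
proof -
  let ?S = "SIGMA n:UNIV. {..n} \<times> (UNIV :: nat set)"
  \<comment> \<open>The map preserves \<open>?S\<close> since j \<le> j + k, and is its own inverse
    there since j + (n - j) = n for j \<le> n; hence one witness serves both directions.\<close>
  have "infsum (qterm q a b t) ?S = infsum (qterm q a t b) ?S"
    by (rule infsum_reindex_bij_witness[where i = "\<lambda>(n, j, k). (j + k, j, n - j)"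
          and j = "\<lambda>(n, j, k). (j + k, j, n - j)"])
      (auto simp: qterm_swap[OF assms(1), symmetric])
  then show ?thesis
    using qseries_sums_infsum_qterm[OF assms, of a]
      qseries_sums_infsum_qterm[OF assms(1) assms(3) assms(2), of a]
    by (simp only: sums_iff)
qed

end
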